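(* Let $\Psi:\mathbb{N}\to\mathbb{R}^+$ be a decreasing function, and suppose that $\alpha\in[0,1)$ is irrational. Then there exist a real number $\gamma$ and a strictly increasing sequence $\{s_k\}_{k=1}^\infty$ of positive integers such that \[ \|s_k\alpha-\gamma\|\le \Psi(s_k)\quad\text{for all } k\ge 1 . \]
   Context: $\mathbb{N}$ denotes the positive integers and $\mathbb{R}^+$ the positive real numbers. For $x\in\mathbb{R}$, $\|x\|$ denotes the distance from $x$ to the nearest integer. *)

theory Defs
  imports "HOL-Analysis.Analysis"
begin

definition dist_nearest_int :: "real \<Rightarrow> real"
  where "dist_nearest_int x = infdist x \<int>"

end

theory Submission
  imports Defs
begin

text \<open>For each \<open>N\<close>, the \<open>\<gamma>\<close> that are \<open>\<Psi>(n)\<close>-close modulo 1 to \<open>n\<alpha>\<close> for some \<open>n > N\<close> contain an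
  open set that is dense, because the tail of \<open>n\<alpha>\<close> is dense modulo 1. By Baire's theorem some \<open>\<gamma>\<close>
  works for all \<open>N\<close> at once, so it is approximated by infinitely many \<open>n\<close>.\<close>

text \<open>The multiples \<open>k * \<alpha>\<close> with \<open>k > 0\<close> are dense modulo 1.
  Aiming them at the shifted target \<open>x - N * \<alpha>\<close> and taking
  \<open>n = k + N\<close> forces the index past \<open>N\<close>.\<close>

lemma tail_dense_mod_1:
  fixes \<alpha> x \<epsilon> :: real
  assumes "\<alpha> \<notin> \<rat>" and "\<epsilon> > 0"
  obtains n :: nat and h :: int where "n > N" "\<bar>real n * \<alpha> - of_int h - x\<bar> < \<epsilon>"
proof -
  obtain h k :: int where k: "k > 0" "\<bar>of_int k * \<alpha> - of_int h - (x - real N * \<alpha>)\<bar> < \<epsilon>"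
    using sequence_of_fractional_parts_is_dense[OF assms] by blast
  then have "real (nat k + N) * \<alpha> = of_int k * \<alpha> + real N * \<alpha>"
    by (simp add: algebra_simps)
  with k show thesis
    by (intro that[of "nat k + N" h]) (simp_all add: algebra_simps)
qed

lemma dist_nearest_int_le: "dist_nearest_int x \<le> \<bar>x - of_int h\<bar>"
  unfolding dist_nearest_int_def by (metis Ints_of_int dist_real_def infdist_le)

lemma exists_infinitely_often_approximated:
  fixes \<Psi> :: "nat \<Rightarrow> real" and \<alpha> :: real
  assumes pos: "\<And>n. n \<ge> 1 \<Longrightarrow> \<Psi> n > 0" and irrat: "\<alpha> \<notin> \<rat>"
  shows "\<exists>\<gamma>. infinite {n. n \<ge> 1 \<and> dist_nearest_int (real n * \<alpha> - \<gamma>) \<le> \<Psi> n}"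
proof -
  \<comment> \<open>The union over all integers \<open>h\<close> lifts the condition modulo 1 to the
    real line, a complete space.\<close>
  define G :: "nat \<Rightarrow> real set"
    where "G N = (\<Union>n\<in>{N<..}. \<Union>h::int. ball (real n * \<alpha> - of_int h) (\<Psi> n))" for N
  have "x \<in> closure (G N)" for N x
    unfolding closure_approachable
  proof (intro allI impI)
    fix \<epsilon> :: real assume "\<epsilon> > 0"
    then obtain n :: nat and h :: int where n: "n > N" "\<bar>real n * \<alpha> - of_int h - x\<bar> < \<epsilon>"
      using tail_dense_mod_1[OF irrat] by blast
    \<comment> \<open>A positive radius puts the centre of the ball into \<open>G N\<close>;
      \<open>n > N\<close> ensures \<open>n \<ge> 1\<close>.\<close>
    have "\<Psi> n > 0"
      using n by (intro pos) simp
    then have "real n * \<alpha> - of_int h \<in> G N"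
      using n unfolding G_def by (intro UN_I[of n] UN_I[of h]) simp_all
    with n show "\<exists>y\<in>G N. dist y x < \<epsilon>"
      by (auto simp: dist_real_def)
  qed
  moreover have "open (G N)" for N
    unfolding G_def by (intro open_UN ballI open_ball)
  \<comment> \<open>The family is countable, being indexed by \<open>N\<close>, so its intersection
    is dense and in particular nonempty.\<close>
  ultimately have "UNIV \<subseteq> closure (\<Inter> (range G))"
    by (intro Baire) auto
  then have "\<Inter> (range G) \<noteq> {}"
    by force
  then obtain \<gamma> where \<gamma>: "\<gamma> \<in> G N" for N
    by blast
  have "\<exists>n>N. n \<ge> 1 \<and> dist_nearest_int (real n * \<alpha> - \<gamma>) \<le> \<Psi> n" for N
  proof -
    obtain n h where "n > N" and h: "\<bar>real n * \<alpha> - of_int h - \<gamma>\<bar> < \<Psi> n"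
      using \<gamma>[of N] by (auto simp: G_def dist_real_def)
    have "dist_nearest_int (real n * \<alpha> - \<gamma>) \<le> \<Psi> n"
      using h dist_nearest_int_le[of "real n * \<alpha> - \<gamma>" h] by (simp add: algebra_simps)
    with \<open>n > N\<close> show ?thesis
      by (intro exI[of _ n]) simp
  qed
  then show ?thesis
    by (intro exI[of _ \<gamma>]) (simp add: infinite_nat_iff_unbounded)
qed

theorem theorem2p6:
  fixes \<Psi> :: "nat \<Rightarrow> real" and \<alpha> :: real
  assumes "\<forall>n\<ge>1. \<Psi> n > 0"
    and "antimono_on {1..} \<Psi>"
    and "\<alpha> \<in> {0..<1}"
    and "\<alpha> \<notin> \<rat>"
  shows "\<exists>(\<gamma>::real) (s :: nat \<Rightarrow> nat).
           strict_mono_on {1..} s \<and>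
           (\<forall>k\<ge>1. s k \<ge> 1 \<and> dist_nearest_int (real (s k) * \<alpha> - \<gamma>) \<le> \<Psi> (s k))"
proof -
  obtain \<gamma> where inf: "infinite {n. n \<ge> 1 \<and> dist_nearest_int (real n * \<alpha> - \<gamma>) \<le> \<Psi> n}"
    (is "infinite ?S")
    using exists_infinitely_often_approximated assms(1,4) by blast
  \<comment> \<open>\<open>enumerate\<close> lists \<open>?S\<close> increasingly from index 0, so
    the sequence starts at the second smallest element.\<close>
  have "strict_mono_on {1..} (enumerate ?S)"
    by (intro strict_mono_onI enumerate_mono inf)
  moreover have "enumerate ?S k \<in> ?S" for k
    by (rule enumerate_in_set[OF inf])
  ultimately show ?thesis
    by (intro exI[of _ \<gamma>] exI[of _ "enumerate ?S"]) simp
qed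

end
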